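(* Let $\tau:\mathbb{O}\to\mathbb{O}$ be the octonion automorphism given by $$\tau(1)=1,\ \tau(e_3)=e_3,\ \tau(e_1)=e_2,\ \tau(e_2)=-e_4,\ \tau(e_4)=-e_1,\ \tau(e_5)=-e_7,\ \tau(e_7)=e_6,\ \tau(e_6)=-e_5.$$ Let $L_C,L_A,L_D,L_E\subset\mathbb{O}$ be the octonionic orders with the $\mathbb{Z}$-bases listed in the context. Then each $L\in\{L_C,L_A,L_D,L_E\}$ is stable under $\tau$, i.e. $\tau(L)=L$. Consequently, each such $L$ is closed under the para-octonionic product $x\bullet y=\overline{x}\cdot\overline{y}$ and under the Okubo product $x*y=\tau(\overline{x})\cdot\tau^{2}(\overline{y})$. Each such $L$ is a $\mathbb{Z}$-integral system relative to the idempotent $1$ for each of the three composition algebras $(\mathbb{O},\cdot,n)$, $(\mathbb{O},\bullet,n)$ and $(\mathbb{O},*,n)$.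
   Context: Octonions: $\mathbb{O}$ is the real algebra with basis $e_0=1,e_1,\dots,e_7$, where $1$ is the unit, $e_k^2=-1$ for $k\ge 1$, $e_ie_j=-e_je_i$ for distinct $i,j\geq 1$, and $e_ie_j=e_k$ whenever $(i,j,k)$ is a cyclic permutation of one of the seven oriented triples $(1,2,4),(1,3,7),(2,3,6),(4,3,5),(6,1,5),(5,2,7),(7,4,6)$. Conjugation is $\overline{x_0+\sum_{k\ge1} x_ke_k}=x_0-\sum_{k\ge1} x_ke_k$, the norm is $n(x)=\sum_{k=0}^7x_k^2=x\overline{x}$, and $\langle x,y\rangle=x\overline{y}+y\overline{x}$, so $\langle x,x\rangle=2n(x)$. Orders (each is the $\mathbb{Z}$-span of the listed basis): $L_C$: $1,e_1,\dots,e_7$. $L_A$: $p_0=1$, $p_1=\frac{-1+e_5-e_6-e_7}{2}$, $p_2=\frac{-e_2+e_4+e_5+e_6}{2}$, $p_3=\frac{-e_1+e_2-e_3-e_4}{2}$, $p_4=\frac{e_2+e_3+e_5+e_7}{2}$, $p_5=\frac{e_1-e_2-e_3-e_4}{2}$, $p_6=\frac{e_1+e_2+e_6-e_7}{2}$, $p_7=\frac{-e_1-e_2+e_3-e_4}{2}$. $L_D$: $d_0=1$, $d_1=e_1$, $d_2=e_2$, $d_3=\frac{1+e_1+e_2+e_4}{2}$, $d_4=e_3$, $d_5=e_1e_3$, $d_6=e_2e_3$, $d_7=d_3e_3$. $L_E$ (Coxeter--Dickson order): $b_0=1$, $b_1=e_1$, $b_2=e_2$, $b_3=e_3$, $b_4=h$,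 $b_5=e_1h$, $b_6=e_2h$, $b_7=e_3h$, where $h=\frac{e_1+e_2+e_3+e_4}{2}$. Integral systems: let $A$ be an eight-dimensional real composition algebra with product $\circ$, norm $n$ (so $n(x\circ y)=n(x)n(y)$), and a chosen nonzero idempotent $e$. A $\mathbb{Z}$-integral system relative to $e$ is a free $\mathbb{Z}$-module $L\subset A$ of rank eight such that: (1) $e\in L$ and $L$ is closed under $\circ$; (2) $n(x)\in\mathbb{Z}$ and $\operatorname{tr}_e(x)=\langle x,e\rangle\in\mathbb{Z}$ for every $x\in L$; (3) $L$ is a discrete Euclidean lattice for the bilinear form associated with $n$. *)

theory Defs
  imports "HOL-Analysis.Analysis"
begin

section \<open>Octonions\<close>

text \<open>
  The index type \<^typ>\<open>8\<close> has the elements 0, ..., 7.  The product \<open>(*)\<close> and the unit \<open>1\<close> that the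
  library provides on \<^typ>\<open>real ^ 8\<close> are the componentwise ones (so \<open>1\<close> is the all-ones vector);
  they are not used.  The unit octonion is \<open>oct_e 0\<close>.
\<close>

type_synonym octonion = "real ^ 8"

definition oct_e :: "8 \<Rightarrow> octonion" where
  "oct_e k = axis k 1"

definition oct_triples :: "(8 \<times> 8 \<times> 8) set" where
  "oct_triples = {(1,2,4), (1,3,7), (2,3,6), (4,3,5), (6,1,5), (5,2,7), (7,4,6)}"

definition oct_cyclic_triples :: "(8 \<times> 8 \<times> 8) set" where
  "oct_cyclic_triples =
     {(i, j, k). (i, j, k) \<in> oct_triples \<or> (j, k, i) \<in> oct_triples \<or> (k, i, j) \<in> oct_triples}"

text \<open>Structure constants: \<open>oct_coeff i j k\<close> is the coefficient of \<open>e\<^sub>k\<close> in \<open>e\<^sub>i e\<^sub>j\<close>.\<close>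

definition oct_coeff :: "8 \<Rightarrow> 8 \<Rightarrow> 8 \<Rightarrow> real" where
  "oct_coeff i j k =
     (if i = 0 then of_bool (k = j)
      else if j = 0 then of_bool (k = i)
      else if i = j then - of_bool (k = 0)
      else if (i, j, k) \<in> oct_cyclic_triples then 1
      else if (j, i, k) \<in> oct_cyclic_triples then - 1
      else 0)"

definition oct_mult :: "octonion \<Rightarrow> octonion \<Rightarrow> octonion" (infixl \<open>\<cdot>\<close> 70) where
  "x \<cdot> y = (\<chi> k. \<Sum>i\<in>UNIV. \<Sum>j\<in>UNIV. oct_coeff i j k * x $ i * y $ j)"

definition oct_cnj :: "octonion \<Rightarrow> octonion" where
  "oct_cnj x = (\<chi> k. if k = 0 then x $ k else - (x $ k))"

definition oct_n :: "octonion \<Rightarrow> real" where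
  "oct_n x = (\<Sum>k\<in>UNIV. (x $ k)\<^sup>2)"

definition oct_automorphism :: "(octonion \<Rightarrow> octonion) \<Rightarrow> bool" where
  "oct_automorphism \<tau> \<longleftrightarrow> linear \<tau> \<and> bij \<tau> \<and> (\<forall>x y. \<tau> (x \<cdot> y) = \<tau> x \<cdot> \<tau> y)"

definition para_mult :: "octonion \<Rightarrow> octonion \<Rightarrow> octonion" where
  "para_mult x y = oct_cnj x \<cdot> oct_cnj y"

definition okubo_mult :: "(octonion \<Rightarrow> octonion) \<Rightarrow> octonion \<Rightarrow> octonion \<Rightarrow> octonion" where
  "okubo_mult \<tau> x y = \<tau> (oct_cnj x) \<cdot> (\<tau> ^^ 2) (oct_cnj y)"


section \<open>Real vector spaces as modules over the integers\<close>

global_interpretation int_module: module "\<lambda>(k::int) (x::'a::real_vector). of_int k *\<^sub>R x"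
  defines int_span = int_module.span
    and int_dependent = int_module.dependent
  by unfold_locales (simp_all add: scaleR_add_right scaleR_add_left)

definition free_int_module_of_rank :: "nat \<Rightarrow> 'a::real_vector set \<Rightarrow> bool" where
  "free_int_module_of_rank r L \<longleftrightarrow>
     (\<exists>B. finite B \<and> card B = r \<and> \<not> int_dependent B \<and> L = int_span B)"


section \<open>Composition algebras and integral systems\<close>

definition polar :: "('a::real_vector \<Rightarrow> real) \<Rightarrow> 'a \<Rightarrow> 'a \<Rightarrow> real" where
  "polar n x y = n (x + y) - n x - n y"

definition quadratic_form :: "('a::real_vector \<Rightarrow> real) \<Rightarrow> bool" where
  "quadratic_form n \<longleftrightarrow> (\<forall>a x. n (a *\<^sub>R x) = a\<^sup>2 * n x) \<and> bilinear (polar n)"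

text \<open>No unit is required: the para-octonion and Okubo algebras are not unital.\<close>

definition composition_algebra ::
    "('a::real_vector \<Rightarrow> 'a \<Rightarrow> 'a) \<Rightarrow> ('a \<Rightarrow> real) \<Rightarrow> bool" where
  "composition_algebra m n \<longleftrightarrow>
     bilinear m \<and> quadratic_form n \<and>
     (\<forall>x. (\<forall>y. polar n x y = 0) \<longrightarrow> x = 0) \<and>
     (\<forall>x y. n (m x y) = n x * n y)"

text \<open>
  Discreteness refers to the distance given by the form \<open>b\<close>, which is an inner product by the
  preceding conditions.
\<close>

definition euclidean_lattice :: "('a::real_vector \<Rightarrow> 'a \<Rightarrow> real) \<Rightarrow> 'a set \<Rightarrow> bool" where
  "euclidean_lattice b L \<longleftrightarrow>
     bilinear b \<and> (\<forall>x y. b x y = b y x) \<and> (\<forall>x. x \<noteq> 0 \<longrightarrow> b x x > 0) \<and>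
     0 \<in> L \<and> (\<forall>x\<in>L. \<forall>y\<in>L. x - y \<in> L) \<and> span L = UNIV \<and>
     (\<forall>x\<in>L. \<exists>\<epsilon>>0. \<forall>y\<in>L. sqrt (b (y - x) (y - x)) < \<epsilon> \<longrightarrow> y = x)"

lemma UNIV_8: "(UNIV :: 8 set) = {0, 1, 2, 3, 4, 5, 6, 7}"
proof (rule sym, rule card_subset_eq)
  show "card {0, 1, 2, 3, 4, 5, 6, 7 :: 8} = card (UNIV :: 8 set)" by simp
qed auto

lemma sum_8: "(\<Sum>i\<in>(UNIV :: 8 set). f i) = f 0 + f 1 + f 2 + f 3 + f 4 + f 5 + f 6 + f 7"
  unfolding UNIV_8 by (simp add: add.assoc)

lemma forall_8: "(\<forall>i::8. P i) \<longleftrightarrow> P 0 \<and> P 1 \<and> P 2 \<and> P 3 \<and> P 4 \<and> P 5 \<and> P 6 \<and> P 7"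
  using UNIV_8 by (metis UNIV_I insert_iff empty_iff)

lemma neq_8:
  "(0::8) \<noteq> 1"  "(0::8) \<noteq> 2"  "(0::8) \<noteq> 3"  "(0::8) \<noteq> 4"  "(0::8) \<noteq> 5"
  "(0::8) \<noteq> 6"  "(0::8) \<noteq> 7"  "(1::8) \<noteq> 0"  "(1::8) \<noteq> 2"  "(1::8) \<noteq> 3"
  "(1::8) \<noteq> 4"  "(1::8) \<noteq> 5"  "(1::8) \<noteq> 6"  "(1::8) \<noteq> 7"  "(2::8) \<noteq> 0"
  "(2::8) \<noteq> 1"  "(2::8) \<noteq> 3"  "(2::8) \<noteq> 4"  "(2::8) \<noteq> 5"  "(2::8) \<noteq> 6"
  "(2::8) \<noteq> 7"  "(3::8) \<noteq> 0"  "(3::8) \<noteq> 1"  "(3::8) \<noteq> 2"  "(3::8) \<noteq> 4"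
  "(3::8) \<noteq> 5"  "(3::8) \<noteq> 6"  "(3::8) \<noteq> 7"  "(4::8) \<noteq> 0"  "(4::8) \<noteq> 1"
  "(4::8) \<noteq> 2"  "(4::8) \<noteq> 3"  "(4::8) \<noteq> 5"  "(4::8) \<noteq> 6"  "(4::8) \<noteq> 7"
  "(5::8) \<noteq> 0"  "(5::8) \<noteq> 1"  "(5::8) \<noteq> 2"  "(5::8) \<noteq> 3"  "(5::8) \<noteq> 4"
  "(5::8) \<noteq> 6"  "(5::8) \<noteq> 7"  "(6::8) \<noteq> 0"  "(6::8) \<noteq> 1"  "(6::8) \<noteq> 2"
  "(6::8) \<noteq> 3"  "(6::8) \<noteq> 4"  "(6::8) \<noteq> 5"  "(6::8) \<noteq> 7"  "(7::8) \<noteq> 0"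
  "(7::8) \<noteq> 1"  "(7::8) \<noteq> 2"  "(7::8) \<noteq> 3"  "(7::8) \<noteq> 4"  "(7::8) \<noteq> 5"
  "(7::8) \<noteq> 6"
  by simp_all

lemma oct_triples_iff:
  "(i, j, k) \<in> oct_triples \<longleftrightarrow>
     i = 1 \<and> j = 2 \<and> k = 4 \<or> i = 1 \<and> j = 3 \<and> k = 7 \<or> i = 2 \<and> j = 3 \<and> k = 6 \<or>
     i = 4 \<and> j = 3 \<and> k = 5 \<or> i = 6 \<and> j = 1 \<and> k = 5 \<or> i = 5 \<and> j = 2 \<and> k = 7 \<or>
     i = 7 \<and> j = 4 \<and> k = 6"
  by (simp add: oct_triples_def)

lemma oct_cyclic_triples_iff:
  "(i, j, k) \<in> oct_cyclic_triples \<longleftrightarrow>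
     (i, j, k) \<in> oct_triples \<or> (j, k, i) \<in> oct_triples \<or> (k, i, j) \<in> oct_triples"
  by (simp add: oct_cyclic_triples_def)

lemmas oct_coeff_eval = oct_coeff_def oct_cyclic_triples_iff oct_triples_iff neq_8
  refl simp_thms if_True if_False of_bool_eq

lemma polar_oct_n: "x \<cdot> oct_cnj y + y \<cdot> oct_cnj x = polar oct_n x y *\<^sub>R oct_e 0"
proof -
  have "polar oct_n x y = (\<Sum>k\<in>UNIV. 2 * (x $ k * y $ k))"
    by (simp add: polar_def oct_n_def power2_sum sum.distrib algebra_simps)
  moreover have "\<forall>k. (x \<cdot> oct_cnj y) $ k + (y \<cdot> oct_cnj x) $ k
      = (\<Sum>k\<in>UNIV. 2 * (x $ k * y $ k)) * oct_e 0 $ k"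
    unfolding oct_mult_def oct_cnj_def oct_e_def axis_def vec_lambda_beta forall_8 sum_8
    by (simp only: oct_coeff_eval) simp
  ultimately show ?thesis
    by (simp add: vec_eq_iff)
qed

text \<open>
  The form \<open>\<langle>x, y\<rangle>\<close> associated with \<open>n\<close> is \<open>polar n x y\<close>, normalised by \<open>\<langle>x, x\<rangle> = 2 n x\<close>; by
  \<open>polar_oct_n\<close> it is \<open>x (cnj y) + y (cnj x)\<close> on the octonions.
\<close>

definition integral_system ::
    "('a::real_vector \<Rightarrow> 'a \<Rightarrow> 'a) \<Rightarrow> ('a \<Rightarrow> real) \<Rightarrow> 'a \<Rightarrow> 'a set \<Rightarrow> bool" where
  "integral_system m n e L \<longleftrightarrow>
     dim (UNIV :: 'a set) = 8 \<and> composition_algebra m n \<and> e \<noteq> 0 \<and> m e e = e \<and>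
     free_int_module_of_rank 8 L \<and>
     e \<in> L \<and> (\<forall>x\<in>L. \<forall>y\<in>L. m x y \<in> L) \<and>
     (\<forall>x\<in>L. n x \<in> \<int> \<and> polar n x e \<in> \<int>) \<and>
     euclidean_lattice (polar n) L"


section \<open>The four orders\<close>

definition order_C :: "octonion set" where
  "order_C = int_span (range oct_e)"

definition order_A :: "octonion set" where
  "order_A = int_span
     {oct_e 0,
      (1/2) *\<^sub>R (- oct_e 0 + oct_e 5 - oct_e 6 - oct_e 7),
      (1/2) *\<^sub>R (- oct_e 2 + oct_e 4 + oct_e 5 + oct_e 6),
      (1/2) *\<^sub>R (- oct_e 1 + oct_e 2 - oct_e 3 - oct_e 4),
      (1/2) *\<^sub>R (oct_e 2 + oct_e 3 + oct_e 5 + oct_e 7),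
      (1/2) *\<^sub>R (oct_e 1 - oct_e 2 - oct_e 3 - oct_e 4),
      (1/2) *\<^sub>R (oct_e 1 + oct_e 2 + oct_e 6 - oct_e 7),
      (1/2) *\<^sub>R (- oct_e 1 - oct_e 2 + oct_e 3 - oct_e 4)}"

definition order_D :: "octonion set" where
  "order_D =
     (let d = (1/2) *\<^sub>R (oct_e 0 + oct_e 1 + oct_e 2 + oct_e 4)
      in int_span {oct_e 0, oct_e 1, oct_e 2, d,
                   oct_e 3, oct_e 1 \<cdot> oct_e 3, oct_e 2 \<cdot> oct_e 3, d \<cdot> oct_e 3})"

definition order_E :: "octonion set" where
  "order_E =
     (let h = (1/2) *\<^sub>R (oct_e 1 + oct_e 2 + oct_e 3 + oct_e 4)
      in int_span {oct_e 0, oct_e 1, oct_e 2, oct_e 3,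
                   h, oct_e 1 \<cdot> h, oct_e 2 \<cdot> h, oct_e 3 \<cdot> h})"

end

(*
  Everything is checked on bases.  Multiplication is bilinear and \<tau> is linear, so an order is closed
  under both once products and images of basis vectors have integer coordinates; closure under
  conjugation follows from cnj x = <x, 1> 1 - x, and \<tau> maps an order onto itself because \<tau>^3 is
  the identity.  Conjugation and \<tau> are isometries fixing 1, so the three products have the
  form f x \<cdot> g y with isometries f and g that preserve the order.  The lattice is discrete because
  <x, x> is an integer on it.
*)
theory Submission
  imports Defs
begin

section \<open>Coordinates\<close>

text \<open>Every imaginary unit lies in three of the seven triples, so its coordinate has three
  antisymmetric pairs besides the two terms with a real part. This table turns later identities into
  polynomial identities in coordinates.\<close>

lemma oct_mult_nth:
  "(x \<cdot> y) $ 0 = x$0 * y$0 - x$1 * y$1 - x$2 * y$2 - x$3 * y$3 - x$4 * y$4 - x$5 * y$5 - x$6 * y$6 - x$7 * y$7"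
  "(x \<cdot> y) $ 1 = x$0 * y$1 + x$1 * y$0 + x$2 * y$4 - x$4 * y$2 + x$3 * y$7 - x$7 * y$3 + x$5 * y$6 - x$6 * y$5"
  "(x \<cdot> y) $ 2 = x$0 * y$2 + x$2 * y$0 - x$1 * y$4 + x$4 * y$1 + x$3 * y$6 - x$6 * y$3 - x$5 * y$7 + x$7 * y$5"
  "(x \<cdot> y) $ 3 = x$0 * y$3 + x$3 * y$0 - x$1 * y$7 + x$7 * y$1 - x$2 * y$6 + x$6 * y$2 - x$4 * y$5 + x$5 * y$4"
  "(x \<cdot> y) $ 4 = x$0 * y$4 + x$4 * y$0 + x$1 * y$2 - x$2 * y$1 + x$3 * y$5 - x$5 * y$3 + x$6 * y$7 - x$7 * y$6"
  "(x \<cdot> y) $ 5 = x$0 * y$5 + x$5 * y$0 - x$1 * y$6 + x$6 * y$1 + x$2 * y$7 - x$7 * y$2 - x$3 * y$4 + x$4 * y$3"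
  "(x \<cdot> y) $ 6 = x$0 * y$6 + x$6 * y$0 + x$1 * y$5 - x$5 * y$1 + x$2 * y$3 - x$3 * y$2 - x$4 * y$7 + x$7 * y$4"
  "(x \<cdot> y) $ 7 = x$0 * y$7 + x$7 * y$0 + x$1 * y$3 - x$3 * y$1 - x$2 * y$5 + x$5 * y$2 + x$4 * y$6 - x$6 * y$4"
  unfolding oct_mult_def vec_lambda_beta sum_8
  by (simp_all only: oct_coeff_eval)

lemma oct_cnj_nth:
  "oct_cnj x $ 0 = x$0" "oct_cnj x $ 1 = - x$1" "oct_cnj x $ 2 = - x$2" "oct_cnj x $ 3 = - x$3"
  "oct_cnj x $ 4 = - x$4" "oct_cnj x $ 5 = - x$5" "oct_cnj x $ 6 = - x$6" "oct_cnj x $ 7 = - x$7"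
  by (simp_all add: oct_cnj_def)

lemma oct_e_nth: "oct_e k $ j = (if j = k then 1 else 0)"
  by (simp add: oct_e_def axis_def)

lemma inner_8:
  "(x::octonion) \<bullet> y = x$0 * y$0 + x$1 * y$1 + x$2 * y$2 + x$3 * y$3
     + x$4 * y$4 + x$5 * y$5 + x$6 * y$6 + x$7 * y$7"
  by (simp add: inner_vec_def sum_8)

text \<open>The map \<tau> in coordinates: entry k reads the coordinate of the unit that \<tau>
  sends to e_k up to sign. For example, \<tau>(e_4) = -e_1 puts \<open>- x$4\<close> into entry
  1.\<close>

definition oct_tau :: "octonion \<Rightarrow> octonion" where
  "oct_tau x = (\<chi> k. if k = 1 then - x$4 else if k = 2 then x$1 else if k = 4 then - x$2
     else if k = 5 then - x$6 else if k = 6 then x$7 else if k = 7 then - x$5 else x$k)"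

lemma oct_tau_nth:
  "oct_tau x $ 0 = x$0" "oct_tau x $ 1 = - x$4" "oct_tau x $ 2 = x$1" "oct_tau x $ 3 = x$3"
  "oct_tau x $ 4 = - x$2" "oct_tau x $ 5 = - x$6" "oct_tau x $ 6 = x$7" "oct_tau x $ 7 = - x$5"
  by (simp_all add: oct_tau_def)

lemmas oct_nth = oct_mult_nth oct_cnj_nth oct_tau_nth oct_e_nth

lemma oct_expansion: "x = (\<Sum>k\<in>UNIV. x $ k *\<^sub>R oct_e k)"
  by (simp add: vec_eq_iff oct_e_nth forall_8 sum_8)


section \<open>The three composition algebras\<close>

lemma oct_n_inner: "oct_n x = x \<bullet> x"
  by (simp add: oct_n_def inner_vec_def power2_eq_square)

lemma polar_oct_n_inner: "polar oct_n x y = 2 * (x \<bullet> y)"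
  by (simp add: polar_def oct_n_inner inner_add inner_commute)

lemma bilinear_polar_oct_n: "bilinear (polar oct_n)"
  by (auto simp: bilinear_def polar_oct_n_inner intro!: linearI simp: algebra_simps)

text \<open>Degen's eight-square identity.\<close>

lemma oct_n_mult: "oct_n (x \<cdot> y) = oct_n x * oct_n y"
  unfolding oct_n_inner inner_8 oct_mult_nth by (simp add: algebra_simps)

lemma oct_n_cnj [simp]: "oct_n (oct_cnj x) = oct_n x"
  by (simp add: oct_n_inner inner_8 oct_nth)

lemma oct_n_tau [simp]: "oct_n (oct_tau x) = oct_n x"
  by (simp add: oct_n_inner inner_8 oct_nth)

lemma linear_oct_cnj: "linear oct_cnj"
  by (rule linearI) (simp_all add: vec_eq_iff forall_8 oct_nth)

lemma linear_oct_tau: "linear oct_tau"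
  by (rule linearI) (simp_all add: vec_eq_iff forall_8 oct_nth)

lemma bilinear_oct_mult: "bilinear oct_mult"
  unfolding bilinear_def
  by (intro conjI allI linearI) (simp_all add: vec_eq_iff forall_8 oct_nth algebra_simps)

text \<open>Up to sign \<tau> permutes the units in the two 3-cycles (e_1, e_2, e_4) and (e_5, e_7,
  e_6) and fixes e_0 and e_3. Going once around either cycle collects two minus signs, which
  cancel.\<close>

lemma oct_tau_cubed: "oct_tau (oct_tau (oct_tau x)) = x"
  by (simp add: vec_eq_iff forall_8 oct_nth)

lemma oct_tau_mult: "oct_tau (x \<cdot> y) = oct_tau x \<cdot> oct_tau y"
  by (simp add: vec_eq_iff forall_8 oct_nth)

lemma oct_automorphism_tau: "oct_automorphism oct_tau"
  unfolding oct_automorphism_def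
  \<comment> \<open>The square of \<tau> is its two-sided inverse.\<close>
  by (intro conjI allI linear_oct_tau oct_tau_mult
      o_bij[where g = "oct_tau \<circ> oct_tau"]) (auto simp: oct_tau_cubed)

text \<open>Serves all three products: \<open>f\<close> and \<open>g\<close> will be the identity,
  conjugation, or conjugation followed by \<tau> or its square. Isometries do not disturb the
  multiplicativity of the norm.\<close>

lemma composition_algebra_twist:
  assumes "linear f" "linear g" "\<And>x. oct_n (f x) = oct_n x" "\<And>x. oct_n (g x) = oct_n x"
  shows "composition_algebra (\<lambda>x y. f x \<cdot> g y) oct_n"
proof -
  have "bilinear (\<lambda>x y. f x \<cdot> g y)"
    using bilinear_oct_mult assms(1,2)
    by (auto simp: bilinear_def intro: linear_compose[unfolded o_def])
  moreover have "quadratic_form oct_n"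
    using bilinear_polar_oct_n by (auto simp: quadratic_form_def oct_n_inner power2_eq_square)
  \<comment> \<open>The form is positive definite, so pairing \<open>x\<close> with itself
    suffices.\<close>
  moreover have "x = 0" if "\<forall>y. polar oct_n x y = 0" for x
    using spec[OF that, of x] by (simp add: polar_oct_n_inner)
  ultimately show ?thesis
    by (auto simp: composition_algebra_def oct_n_mult assms)
qed


section \<open>From a basis to an integral system\<close>

text \<open>The preimage of an integer span under a linear map is closed under integer combinations,
  so it is enough to look at generators.\<close>

lemma int_span_linear_image:
  assumes "linear f" "\<And>a. a \<in> A \<Longrightarrow> f a \<in> int_span C" "x \<in> int_span A"
  shows "f x \<in> int_span C"
  using assms(3)
proof (rule int_module.span_induct)
  show "int_module.subspace {x. f x \<in> int_span C}"
    by (auto simp: int_module.subspace_def linear_0[OF assms(1)] linear_add[OF assms(1)]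
        linear_scale[OF assms(1)] int_module.span_zero intro: int_module.span_add int_module.span_scale)
qed (use assms in auto)

text \<open>Extend by linearity twice: first in the second argument with a generator in the first,
  then in the first argument with \<open>y\<close> fixed.\<close>

lemma int_span_bilinear_image:
  assumes "bilinear m" "\<And>a b. a \<in> A \<Longrightarrow> b \<in> B \<Longrightarrow> m a b \<in> int_span C"
    and "x \<in> int_span A" "y \<in> int_span B"
  shows "m x y \<in> int_span C"
proof -
  have *: "m a y \<in> int_span C" if "a \<in> A" for a
    by (rule int_span_linear_image[where A = B]) (use assms that in \<open>auto simp: bilinear_def\<close>)
  show ?thesis
    by (rule int_span_linear_image[where A = A and f = "\<lambda>x. m x y"])
       (use assms * in \<open>auto simp: bilinear_def\<close>)
qed

text \<open>The integers are the integer span of 1 in the reals, so this is a case of the preceding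
  lemma.\<close>

lemma int_span_bilinear_form_Ints:
  fixes m :: "'a::real_vector \<Rightarrow> 'a \<Rightarrow> real"
  assumes "bilinear m" "\<And>a b. a \<in> A \<Longrightarrow> b \<in> A \<Longrightarrow> m a b \<in> \<int>"
    and "x \<in> int_span A" "y \<in> int_span A"
  shows "m x y \<in> \<int>"
proof -
  have Z: "int_span {1::real} = \<int>"
    by (auto simp: int_module.span_singleton Ints_def)
  show ?thesis
    using int_span_bilinear_image[OF assms(1) _ assms(3,4), of "{1}"] assms(2) Z by simp
qed

text \<open>An integer relation is in particular a real relation.\<close>

lemma int_independent_if_independent:
  assumes "independent B"
  shows "\<not> int_dependent B"
proof
  assume "int_dependent B"
  then obtain t u v where *: "finite t" "t \<subseteq> B" "(\<Sum>v\<in>t. of_int (u v) *\<^sub>R v) = 0" "v \<in> t" "u v \<noteq> (0::int)"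
    unfolding int_module.dependent_explicit by blast
  then have "dependent B"
    unfolding dependent_explicit by (intro exI[of _ t] exI[of _ "\<lambda>v. of_int (u v)"]) auto
  with assms show False by simp
qed

text \<open>Conditions that can be checked on finitely many vectors. Linear independence will come
  from a dimension count. \<open>norm_B\<close> stands beside \<open>inner_B\<close> because the
  latter alone makes only twice the norm integral.\<close>

locale octonion_order_basis =
  fixes B :: "octonion set"
  assumes finite_B: "finite B" and card_B: "card B \<le> 8" and span_B: "span B = UNIV"
    and unit_B: "oct_e 0 \<in> B"
    and mult_B: "\<And>a b. a \<in> B \<Longrightarrow> b \<in> B \<Longrightarrow> a \<cdot> b \<in> int_span B"
    and tau_B: "\<And>a. a \<in> B \<Longrightarrow> oct_tau a \<in> int_span B"
    and norm_B: "\<And>a. a \<in> B \<Longrightarrow> a \<bullet> a \<in> \<int>"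
    and inner_B: "\<And>a b. a \<in> B \<Longrightarrow> b \<in> B \<Longrightarrow> 2 * (a \<bullet> b) \<in> \<int>"
begin

text \<open>A spanning set of an eight-dimensional space has at least eight elements, and with
  exactly eight it is a basis.\<close>

lemma free: "free_int_module_of_rank 8 (int_span B)"
proof -
  have "card B \<ge> 8"
    using dim_le_card[of UNIV B] span_B finite_B by simp
  with card_B have "card B = 8" by simp
  moreover have "independent B"
    using card_le_dim_spanning[of B UNIV] span_B finite_B \<open>card B = 8\<close> by simp
  ultimately show ?thesis
    unfolding free_int_module_of_rank_def
    using finite_B int_independent_if_independent by blast
qed

lemma polar_int: "x \<in> int_span B \<Longrightarrow> y \<in> int_span B \<Longrightarrow> polar oct_n x y \<in> \<int>"
  by (rule int_span_bilinear_form_Ints[OF bilinear_polar_oct_n, of B])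
     (simp_all add: polar_oct_n_inner inner_B)

lemma norm_int:
  assumes "x \<in> int_span B"
  shows "oct_n x \<in> \<int>"
proof -
  \<comment> \<open>The norm is not additive: n(x + y) contains the cross term
    \<open>polar oct_n x y\<close>. Membership is carried through the induction so that
    \<open>polar_int\<close> applies to that term.\<close>
  have "x \<in> int_span B \<and> oct_n x \<in> \<int>"
    using assms
  proof (rule int_module.span_induct)
    have "oct_n (x + y) = oct_n x + polar oct_n x y + oct_n y" for x y
      by (simp add: polar_def)
    then show "int_module.subspace {x. x \<in> int_span B \<and> oct_n x \<in> \<int>}"
      by (auto simp: int_module.subspace_def int_module.span_zero int_module.span_add
          int_module.span_scale polar_int) (simp_all add: oct_n_inner)
    show "a \<in> int_span B \<and> oct_n a \<in> \<int>" if "a \<in> B" for a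
      using that by (simp add: norm_B oct_n_inner int_module.span_base)
  qed
  then show ?thesis by simp
qed

lemma mult_closed: "x \<in> int_span B \<Longrightarrow> y \<in> int_span B \<Longrightarrow> x \<cdot> y \<in> int_span B"
  using int_span_bilinear_image[OF bilinear_oct_mult mult_B] by blast

lemma unit_mem: "oct_e 0 \<in> int_span B"
  by (rule int_module.span_base) (rule unit_B)

lemma cnj_closed:
  assumes "x \<in> int_span B"
  shows "oct_cnj x \<in> int_span B"
proof -
  obtain k where "polar oct_n x (oct_e 0) = of_int k"
    using polar_int[OF assms unit_mem] by (auto elim: Ints_cases)
  moreover have "oct_cnj x = polar oct_n x (oct_e 0) *\<^sub>R oct_e 0 - x"
    by (simp add: polar_oct_n_inner inner_8 vec_eq_iff forall_8 oct_nth)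
  ultimately show ?thesis
    using int_module.span_diff[OF int_module.span_scale[OF unit_mem, of k] assms] by simp
qed

lemma tau_closed: "x \<in> int_span B \<Longrightarrow> oct_tau x \<in> int_span B"
  using int_span_linear_image[OF linear_oct_tau tau_B] .

lemma tau_image: "oct_tau ` int_span B = int_span B"
proof (rule subset_antisym)
  show "int_span B \<subseteq> oct_tau ` int_span B"
    using tau_closed by (metis image_eqI oct_tau_cubed subsetI)
qed (use tau_closed in blast)

lemma lattice: "euclidean_lattice (polar oct_n) (int_span B)"
  unfolding euclidean_lattice_def
proof (intro conjI ballI allI impI)
  show "bilinear (polar oct_n)"
    by (rule bilinear_polar_oct_n)
  have "B \<subseteq> int_span B"
    by (auto intro: int_module.span_base)
  then show "span (int_span B) = UNIV"
    using span_B span_mono by blast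
next
  fix x assume x: "x \<in> int_span B"
  \<comment> \<open>The radius 1 works at every point, because the squared distance is a nonnegative
    integer and must vanish once it is below 1.\<close>
  have "y = x" if y: "y \<in> int_span B" and lt: "sqrt (polar oct_n (y - x) (y - x)) < 1" for y
  proof -
    have "polar oct_n (y - x) (y - x) \<in> \<int>"
      using x y by (intro polar_int int_module.span_diff)
    moreover have "polar oct_n (y - x) (y - x) < 1"
      using lt by simp
    moreover have "polar oct_n (y - x) (y - x) \<ge> 0"
      by (simp add: polar_oct_n_inner)
    ultimately have "polar oct_n (y - x) (y - x) = 0"
      by (auto elim!: Ints_cases)
    then show ?thesis
      by (simp add: polar_oct_n_inner)
  qed
  then show "\<exists>\<epsilon>>0. \<forall>y\<in>int_span B. sqrt (polar oct_n (y - x) (y - x)) < \<epsilon> \<longrightarrow> y = x"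
    by (intro exI[of _ 1]) auto
qed (auto simp: polar_oct_n_inner inner_commute int_module.span_zero int_module.span_diff)

lemma integral_system_twist:
  assumes "linear f" "linear g" "\<And>x. oct_n (f x) = oct_n x" "\<And>x. oct_n (g x) = oct_n x"
    and "f (oct_e 0) = oct_e 0" "g (oct_e 0) = oct_e 0"
    and "\<And>x. x \<in> int_span B \<Longrightarrow> f x \<in> int_span B" "\<And>x. x \<in> int_span B \<Longrightarrow> g x \<in> int_span B"
  shows "integral_system (\<lambda>x y. f x \<cdot> g y) oct_n (oct_e 0) (int_span B)"
  unfolding integral_system_def
proof (intro conjI)
  show "dim (UNIV :: octonion set) = 8"
    by simp
  show "composition_algebra (\<lambda>x y. f x \<cdot> g y) oct_n"
    by (rule composition_algebra_twist) (use assms in auto)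
  show "f (oct_e 0) \<cdot> g (oct_e 0) = oct_e 0"
    by (simp add: assms(5,6) vec_eq_iff forall_8 oct_nth)
  show "oct_e 0 \<noteq> 0"
    by (simp add: oct_e_def)
  show "\<forall>x\<in>int_span B. \<forall>y\<in>int_span B. f x \<cdot> g y \<in> int_span B"
    using assms(7,8) mult_closed by blast
  show "\<forall>x\<in>int_span B. oct_n x \<in> \<int> \<and> polar oct_n x (oct_e 0) \<in> \<int>"
    using norm_int polar_int unit_mem by blast
qed (rule free unit_mem lattice)+

lemma integral_systems:
  "integral_system oct_mult oct_n (oct_e 0) (int_span B)"
  "integral_system para_mult oct_n (oct_e 0) (int_span B)"
  "integral_system (okubo_mult oct_tau) oct_n (oct_e 0) (int_span B)"
proof -
  have fixes_unit: "oct_cnj (oct_e 0) = oct_e 0" "oct_tau (oct_e 0) = oct_e 0"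
    by (simp_all add: vec_eq_iff forall_8 oct_nth)
  have para: "para_mult = (\<lambda>x y. oct_cnj x \<cdot> oct_cnj y)"
    and okubo: "okubo_mult oct_tau = (\<lambda>x y. oct_tau (oct_cnj x) \<cdot> oct_tau (oct_tau (oct_cnj y)))"
    by (simp_all add: fun_eq_iff para_mult_def okubo_mult_def numeral_2_eq_2)
  show "integral_system oct_mult oct_n (oct_e 0) (int_span B)"
    using integral_system_twist[OF linear_ident linear_ident] by simp
  show "integral_system para_mult oct_n (oct_e 0) (int_span B)"
    unfolding para by (rule integral_system_twist)
      (simp_all add: linear_oct_cnj cnj_closed fixes_unit)
  have 1: "linear (\<lambda>x. oct_tau (oct_cnj x))"
    using linear_compose[OF linear_oct_cnj linear_oct_tau] by (simp add: o_def)
  then have 2: "linear (\<lambda>x. oct_tau (oct_tau (oct_cnj x)))"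
    using linear_compose[OF 1 linear_oct_tau] by (simp add: o_def)
  show "integral_system (okubo_mult oct_tau) oct_n (oct_e 0) (int_span B)"
    unfolding okubo by (rule integral_system_twist[OF 1 2])
      (simp_all add: cnj_closed tau_closed fixes_unit)
qed

end


section \<open>The four orders\<close>

lemma sum_list_scaleR_in_span: "sum_list (map2 (*\<^sub>R) cs bs) \<in> span (set bs)"
proof (induction cs bs rule: list_induct2')
  case (4 c cs b bs)
  have "sum_list (map2 (*\<^sub>R) cs bs) \<in> span (set (b # bs))"
    using 4 span_mono[of "set bs" "set (b # bs)"] by auto
  then show ?case
    by (auto intro: span_add span_scale span_base)
\<comment> \<open>In the other cases one list is empty, and \<open>map2\<close> stops at the shorter
  list, so the sum is 0.\<close>
qed (simp_all add: span_zero)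

lemma sum_list_scaleR_in_int_span:
  "set cs \<subseteq> \<int> \<Longrightarrow> sum_list (map2 (*\<^sub>R) cs bs) \<in> int_span (set bs)"
proof (induction cs bs rule: list_induct2')
  case (4 c cs b bs)
  then obtain k where "c = of_int k"
    by (auto elim: Ints_cases)
  moreover have "sum_list (map2 (*\<^sub>R) cs bs) \<in> int_span (set (b # bs))"
    using 4 int_module.span_mono[of "set bs" "set (b # bs)"] by auto
  moreover have "of_int k *\<^sub>R b \<in> int_span (set (b # bs))"
    by (intro int_module.span_scale int_module.span_base) simp
  ultimately show ?case
    by (auto intro: int_module.span_add)
qed (simp_all add: int_module.span_zero)

text \<open>With an explicit coordinate function \<open>cs\<close>, the identity
  \<open>coord\<close> gives spanning, and membership in the integer span follows once the
  coordinates are integers. What remains are finitely many evaluations.\<close>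

lemma octonion_order_basisI:
  assumes "length bs = 8" "oct_e 0 \<in> set bs"
    and coord: "\<And>x. x = sum_list (map2 (*\<^sub>R) (cs x) bs)"
    and mult: "\<forall>a\<in>set bs. \<forall>b\<in>set bs. set (cs (a \<cdot> b)) \<subseteq> \<int>"
    and tau: "\<forall>a\<in>set bs. set (cs (oct_tau a)) \<subseteq> \<int>"
    and "\<forall>a\<in>set bs. a \<bullet> a \<in> \<int>"
    and "\<forall>a\<in>set bs. \<forall>b\<in>set bs. 2 * (a \<bullet> b) \<in> \<int>"
  shows "octonion_order_basis (set bs)"
proof
  have mem: "x \<in> int_span (set bs)" if "set (cs x) \<subseteq> \<int>" for x
    using sum_list_scaleR_in_int_span[OF that, of bs] coord[of x] by simp
  show "span (set bs) = UNIV"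
    using sum_list_scaleR_in_span coord by (metis UNIV_eq_I)
  show "a \<cdot> b \<in> int_span (set bs)" if "a \<in> set bs" "b \<in> set bs" for a b
    using mult that by (intro mem) blast
  show "oct_tau a \<in> int_span (set bs)" if "a \<in> set bs" for a
    using tau that by (intro mem) blast
  show "card (set bs) \<le> 8"
    using card_length[of bs] assms(1) by simp
qed (use assms in auto)

text \<open>
  The coordinate functions passed to \<open>octonion_order_basisI\<close> are read off from the inverses of the
  basis matrices.
\<close>

lemma order_C_basis: "\<exists>B. octonion_order_basis B \<and> order_C = int_span B"
proof (intro exI conjI)
  let ?bs = "[oct_e 0, oct_e 1, oct_e 2, oct_e 3, oct_e 4, oct_e 5, oct_e 6, oct_e 7]"
  let ?cs = "\<lambda>x::octonion. [x$0, x$1, x$2, x$3, x$4, x$5, x$6, x$7]"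
  show "octonion_order_basis (set ?bs)"
  proof (rule octonion_order_basisI[where cs = ?cs])
    show "x = sum_list (map2 (*\<^sub>R) (?cs x) ?bs)" for x
      by (simp add: vec_eq_iff forall_8 oct_nth)
  qed (simp_all add: oct_nth inner_8)
  show "order_C = int_span (set ?bs)"
    by (simp add: order_C_def UNIV_8)
qed

lemma order_A_basis: "\<exists>B. octonion_order_basis B \<and> order_A = int_span B"
proof (intro exI conjI)
  let ?bs = "[oct_e 0,
      (1/2) *\<^sub>R (- oct_e 0 + oct_e 5 - oct_e 6 - oct_e 7),
      (1/2) *\<^sub>R (- oct_e 2 + oct_e 4 + oct_e 5 + oct_e 6),
      (1/2) *\<^sub>R (- oct_e 1 + oct_e 2 - oct_e 3 - oct_e 4),
      (1/2) *\<^sub>R (oct_e 2 + oct_e 3 + oct_e 5 + oct_e 7),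
      (1/2) *\<^sub>R (oct_e 1 - oct_e 2 - oct_e 3 - oct_e 4),
      (1/2) *\<^sub>R (oct_e 1 + oct_e 2 + oct_e 6 - oct_e 7),
      (1/2) *\<^sub>R (- oct_e 1 - oct_e 2 + oct_e 3 - oct_e 4)]"
  \<comment> \<open>For the form \<open>polar oct_n\<close> the basis splits into four mutually
    orthogonal consecutive pairs, each spanning a root lattice A_2 with Gram matrix ((2, -1), (-1,
    2)). Its determinant 3 is the source of the denominators.\<close>
  let ?cs = "\<lambda>x::octonion.
      [(3 * x$0 + x$5 - x$6 - x$7) / 3,
       (2 * x$5 - 2 * x$6 - 2 * x$7) / 3,
       (- x$1 - x$2 - x$3 + x$4 + 2 * x$5 + 2 * x$6) / 3,
       (- 2 * x$1 + x$2 - 2 * x$3 - x$4 + x$5 + x$6) / 3,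
       (x$1 + x$2 + x$3 - x$4 + 2 * x$5 + 2 * x$7) / 3,
       (2 * x$1 - x$2 - x$3 - 2 * x$4 + x$5 + x$7) / 3,
       (x$1 + x$2 + x$3 - x$4 + 2 * x$6 - 2 * x$7) / 3,
       (- x$1 - x$2 + 2 * x$3 - 2 * x$4 + x$6 - x$7) / 3]"
  show "octonion_order_basis (set ?bs)"
  proof (rule octonion_order_basisI[where cs = ?cs])
    show "x = sum_list (map2 (*\<^sub>R) (?cs x) ?bs)" for x
      by (simp add: vec_eq_iff forall_8 oct_nth field_simps)
  qed (simp_all add: oct_nth inner_8)
  show "order_A = int_span (set ?bs)"
    by (simp add: order_A_def)
qed

text \<open>The first four vectors span the Hurwitz order in the quaternion subalgebra on 1, e_1,
  e_2, e_4; the last four are their products with e_3. Hence the two halves of the coordinate list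
  have the same shape.\<close>

lemma order_D_basis: "\<exists>B. octonion_order_basis B \<and> order_D = int_span B"
proof (intro exI conjI)
  let ?bs = "[oct_e 0,
      oct_e 1,
      oct_e 2,
      (1/2) *\<^sub>R (oct_e 0 + oct_e 1 + oct_e 2 + oct_e 4),
      oct_e 3,
      oct_e 7,
      oct_e 6,
      (1/2) *\<^sub>R (oct_e 3 + oct_e 5 + oct_e 6 + oct_e 7)]"
  let ?cs = "\<lambda>x::octonion.
      [x$0 - x$4,
       x$1 - x$4,
       x$2 - x$4,
       2 * x$4,
       x$3 - x$5,
       - x$5 + x$7,
       - x$5 + x$6,
       2 * x$5]"
  show "octonion_order_basis (set ?bs)"
  proof (rule octonion_order_basisI[where cs = ?cs])
    show "x = sum_list (map2 (*\<^sub>R) (?cs x) ?bs)" for x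
      by (simp add: vec_eq_iff forall_8 oct_nth field_simps)
  qed (simp_all add: oct_nth inner_8)
  \<comment> \<open>The products in the definition of \<open>order_D\<close> are evaluated to match
    the explicit list.\<close>
  have "oct_e 1 \<cdot> oct_e 3 = oct_e 7" "oct_e 2 \<cdot> oct_e 3 = oct_e 6"
    "((1/2) *\<^sub>R (oct_e 0 + oct_e 1 + oct_e 2 + oct_e 4)) \<cdot> oct_e 3
      = (1/2) *\<^sub>R (oct_e 3 + oct_e 5 + oct_e 6 + oct_e 7)"
    by (simp_all add: vec_eq_iff forall_8 oct_nth)
  then show "order_D = int_span (set ?bs)"
    by (simp add: order_D_def Let_def)
qed

lemma order_E_basis: "\<exists>B. octonion_order_basis B \<and> order_E = int_span B"
proof (intro exI conjI)
  let ?bs = "[oct_e 0,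
      oct_e 1,
      oct_e 2,
      oct_e 3,
      (1/2) *\<^sub>R (oct_e 1 + oct_e 2 + oct_e 3 + oct_e 4),
      (1/2) *\<^sub>R (- oct_e 0 - oct_e 2 + oct_e 4 + oct_e 7),
      (1/2) *\<^sub>R (- oct_e 0 + oct_e 1 - oct_e 4 + oct_e 6),
      (1/2) *\<^sub>R (- oct_e 0 - oct_e 5 - oct_e 6 - oct_e 7)]"
  let ?cs = "\<lambda>x::octonion.
      [x$0 - 3 * x$5 + x$6 + x$7,
       x$1 - x$4 + x$5 - 2 * x$6 + x$7,
       x$2 - x$4 - x$5 - x$6 + 2 * x$7,
       x$3 - x$4 - x$6 + x$7,
       2 * x$4 + 2 * x$6 - 2 * x$7,
       - 2 * x$5 + 2 * x$7,
       - 2 * x$5 + 2 * x$6,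
       - 2 * x$5]"
  show "octonion_order_basis (set ?bs)"
  proof (rule octonion_order_basisI[where cs = ?cs])
    show "x = sum_list (map2 (*\<^sub>R) (?cs x) ?bs)" for x
      by (simp add: vec_eq_iff forall_8 oct_nth field_simps)
  qed (simp_all add: oct_nth inner_8)
  \<comment> \<open>Here too the left multiples of h are evaluated to match the last three vectors
    of the list.\<close>
  have "oct_e 1 \<cdot> ((1/2) *\<^sub>R (oct_e 1 + oct_e 2 + oct_e 3 + oct_e 4))
      = (1/2) *\<^sub>R (- oct_e 0 - oct_e 2 + oct_e 4 + oct_e 7)"
    "oct_e 2 \<cdot> ((1/2) *\<^sub>R (oct_e 1 + oct_e 2 + oct_e 3 + oct_e 4))
      = (1/2) *\<^sub>R (- oct_e 0 + oct_e 1 - oct_e 4 + oct_e 6)"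
    "oct_e 3 \<cdot> ((1/2) *\<^sub>R (oct_e 1 + oct_e 2 + oct_e 3 + oct_e 4))
      = (1/2) *\<^sub>R (- oct_e 0 - oct_e 5 - oct_e 6 - oct_e 7)"
    by (simp_all add: vec_eq_iff forall_8 oct_nth)
  then show "order_E = int_span (set ?bs)"
    by (simp add: order_E_def Let_def)
qed

theorem proposition8:
  fixes \<tau> :: "octonion \<Rightarrow> octonion"
  assumes "linear \<tau>"
    and "\<tau> (oct_e 0) = oct_e 0" and "\<tau> (oct_e 3) = oct_e 3"
    and "\<tau> (oct_e 1) = oct_e 2" and "\<tau> (oct_e 2) = - oct_e 4" and "\<tau> (oct_e 4) = - oct_e 1"
    and "\<tau> (oct_e 5) = - oct_e 7" and "\<tau> (oct_e 7) = oct_e 6" and "\<tau> (oct_e 6) = - oct_e 5"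
  shows "oct_automorphism \<tau> \<and>
    (\<forall>L\<in>{order_C, order_A, order_D, order_E}.
       \<tau> ` L = L \<and>
       (\<forall>x\<in>L. \<forall>y\<in>L. para_mult x y \<in> L) \<and>
       (\<forall>x\<in>L. \<forall>y\<in>L. okubo_mult \<tau> x y \<in> L) \<and>
       integral_system oct_mult oct_n (oct_e 0) L \<and>
       integral_system para_mult oct_n (oct_e 0) L \<and>
       integral_system (okubo_mult \<tau>) oct_n (oct_e 0) L)"
proof -
  \<comment> \<open>A linear map is determined by its values on the basis, so \<tau> can be replaced
    by the explicit \<open>oct_tau\<close>.\<close>
  have "\<tau> x = oct_tau x" for x
  proof -
    have "\<tau> x = (\<Sum>k\<in>UNIV. x $ k *\<^sub>R \<tau> (oct_e k))"
      using oct_expansion[of x] linear_sum[OF assms(1)] linear_scale[OF assms(1)]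
      by (metis (no_types, lifting) sum.cong)
    then show ?thesis
      by (simp add: sum_8 assms(2-) vec_eq_iff forall_8 oct_nth)
  qed
  then have \<tau>: "\<tau> = oct_tau"
    by blast
  show ?thesis
  proof (intro conjI ballI)
    show "oct_automorphism \<tau>"
      unfolding \<tau> by (rule oct_automorphism_tau)
    fix L assume "L \<in> {order_C, order_A, order_D, order_E}"
    then obtain B where "octonion_order_basis B" and L: "L = int_span B"
      using order_C_basis order_A_basis order_D_basis order_E_basis by blast
    then interpret octonion_order_basis B by simp
    show "\<tau> ` L = L"
      unfolding \<tau> L by (rule tau_image)
    show *: "integral_system oct_mult oct_n (oct_e 0) L" "integral_system para_mult oct_n (oct_e 0) L"
      "integral_system (okubo_mult \<tau>) oct_n (oct_e 0) L"
      unfolding \<tau> L by (rule integral_systems)+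
    \<comment> \<open>Closure under a product is one of the conditions of an integral
      system.\<close>
    show "para_mult x y \<in> L" "okubo_mult \<tau> x y \<in> L" if "x \<in> L" "y \<in> L" for x y
      using *(2,3) that by (simp_all add: integral_system_def)
  qed
qed

end
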